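(* For every infinite cardinal $\kappa$ there is an anti-Urysohn space $Z$ such that $|Z|=\kappa$, $d(Z)=\log\kappa$, and $\bigcap\mathcal A\neq\emptyset$ for every (nonempty) family $\mathcal A\subset \mathrm{RC}^+(Z)$ with $|\mathcal A|<\mathrm{cf}(\kappa)$.
   Context: "Space" means infinite Hausdorff topological space. $\mathrm{RC}^+(X)$ denotes the family of all non-empty regular closed subsets of $X$ (a set is regular closed if it is the closure of its interior). A space $X$ is anti-Urysohn (AU) if $A\cap B\ne\emptyset$ for all $A,B\in \mathrm{RC}^+(X)$. $d(X)$ is the density of $X$ (minimum cardinality of a dense subset). $\log\kappa=\min\{\lambda : 2^\lambda\ge\kappa\}$. *)

theory Defs
  imports "HOL-Analysis.Analysis"
begin

unbundle cardinal_syntax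

text \<open>
  Cardinals are represented, as in the library, by well-orders \<open>r\<close> with \<open>Card_order r\<close>, and are
  compared up to \<open>=o\<close>. The least cardinality of a set with property \<open>P\<close> is therefore meaningful
  up to \<open>=o\<close>; it is a junk value if no set satisfies \<open>P\<close>, which happens in none of the uses below
  (in \<open>cofinality\<close>, as long as the cardinal is infinite).
\<close>

definition least_card :: "('a set \<Rightarrow> bool) \<Rightarrow> 'a rel" where
  "least_card P = |SOME A. P A \<and> (\<forall>B. P B \<longrightarrow> |A| \<le>o |B| )|"

lemma least_card_witness:
  assumes "P A0"
  shows "\<exists>A. P A \<and> least_card P = |A|" and "P B \<Longrightarrow> least_card P \<le>o |B|"
proof -
  have "\<exists>r\<in>card_of ` Collect P. \<forall>r'\<in>card_of ` Collect P. r \<le>o r'"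
    using assms by (intro exists_minim_Card_order) (auto simp: card_of_Card_order)
  then have "\<exists>A. P A \<and> (\<forall>B. P B \<longrightarrow> |A| \<le>o |B| )"
    by auto
  then have *: "P (SOME A. P A \<and> (\<forall>B. P B \<longrightarrow> |A| \<le>o |B| )) \<and>
      (\<forall>B. P B \<longrightarrow> |SOME A. P A \<and> (\<forall>B. P B \<longrightarrow> |A| \<le>o |B| )| \<le>o |B| )"
    by (rule someI_ex)
  show "\<exists>A. P A \<and> least_card P = |A|" and "P B \<Longrightarrow> least_card P \<le>o |B|"
    using * unfolding least_card_def by blast+
qed

text \<open>
  \<open>log \<kappa> = min {\<lambda>. 2\<^sup>\<lambda> \<ge> \<kappa>}\<close>. Since \<open>\<kappa> \<le> 2\<^sup>\<kappa>\<close>, it is enough to let \<open>\<lambda>\<close> range over the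
  cardinalities of sets over the type that carries \<open>\<kappa>\<close>. The name \<open>log\<close> is taken by the real logarithm.
\<close>

definition card_log :: "'a rel \<Rightarrow> 'a rel" where
  "card_log \<kappa> = least_card (\<lambda>A::'a set. \<kappa> \<le>o ctwo ^c |A| )"

text \<open>
  The library's \<open>cofinal\<close> asks for strictly larger elements, so for a well-order without
  greatest element (such as an infinite cardinal) it means unbounded.
\<close>

definition cofinality :: "'a rel \<Rightarrow> 'a rel" where
  "cofinality \<kappa> = least_card (\<lambda>K. K \<subseteq> Field \<kappa> \<and> cofinal K \<kappa>)"

definition top_density :: "'a topology \<Rightarrow> 'a rel" where
  "top_density X = least_card (\<lambda>D. D \<subseteq> topspace X \<and> X closure_of D = topspace X)"

definition RC_plus :: "'a topology \<Rightarrow> 'a set set" where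
  "RC_plus X = {A. A \<noteq> {} \<and> X closure_of (X interior_of A) = A}"

text \<open>By convention, spaces are infinite and Hausdorff.\<close>

definition anti_Urysohn_space :: "'a topology \<Rightarrow> bool" where
  "anti_Urysohn_space X \<longleftrightarrow>
     infinite (topspace X) \<and> Hausdorff_space X \<and>
     (\<forall>A\<in>RC_plus X. \<forall>B\<in>RC_plus X. A \<inter> B \<noteq> {})"

end

theory Submission
  imports Defs "HOL-Algebra.Free_Abelian_Groups"
begin

text \<open>
  Points are coded by partial binary functions on the index set \<open>I = \<kappa> \<times> \<nat>\<close>. A set \<open>D\<close> of
  \<open>log \<kappa>\<close> total functions that is dense in the Cantor cube (Hewitt--Marczewski--Pondiczery) forms
  an open dense subspace. For each \<open>\<alpha> < \<kappa>\<close> there is one further point \<open>p\<^sub>\<alpha>\<close>, a function with domain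
  \<open>[\<alpha>, \<kappa>) \<times> \<nat>\<close>, whose neighbourhoods consist of \<open>p\<^sub>\<alpha>\<close> and of all members of \<open>D\<close> that agree with
  it on a finite part of its domain. A basic open set depends on finitely many coordinates, so
  its closure contains all \<open>p\<^sub>\<alpha>\<close> with \<open>\<alpha>\<close> above these coordinates; fewer than \<open>cf \<kappa>\<close> such tails meet.
  The functions are chosen so that any two points disagree at a common coordinate, which makes
  the space Hausdorff.
\<close>

section \<open>Spaces of partial binary functions\<close>

text \<open>A point \<open>z\<close> is only a name for the function \<open>c z\<close> restricted
  to \<open>dm z\<close>; values off \<open>dm z\<close> carry no meaning. This allows the topology
  to live on a prescribed carrier. The assumption \<open>dense\<close> is density of
  \<open>D\<close> in the Cantor cube over \<open>I\<close>.\<close>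

locale partial_function_space =
  fixes Q D :: "'a set" and I :: "'i set" and dm :: "'a \<Rightarrow> 'i set" and c :: "'a \<Rightarrow> 'i \<Rightarrow> bool"
  assumes D_subset: "D \<subseteq> Q"
    and dm_D: "d \<in> D \<Longrightarrow> dm d = I"
    and dm_subset: "z \<in> Q \<Longrightarrow> dm z \<subseteq> I"
    and separated: "\<lbrakk>y \<in> Q; z \<in> Q; y \<noteq> z\<rbrakk> \<Longrightarrow> \<exists>i \<in> dm y \<inter> dm z. c y i \<noteq> c z i"
    and dense: "\<lbrakk>finite S; S \<subseteq> I\<rbrakk> \<Longrightarrow> \<exists>d\<in>D. \<forall>i\<in>S. c d i = s i"
begin

definition nbhd :: "'a \<Rightarrow> 'i set \<Rightarrow> 'a set" where
  "nbhd z S = insert z {d\<in>D. \<forall>i\<in>S. c d i = c z i}"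

definition open_set :: "'a set \<Rightarrow> bool" where
  "open_set U \<longleftrightarrow> U \<subseteq> Q \<and> (\<forall>z\<in>U. \<exists>S. finite S \<and> S \<subseteq> dm z \<and> nbhd z S \<subseteq> U)"

definition pf_topology :: "'a topology" where
  "pf_topology = topology open_set"

lemma nbhd_self: "z \<in> nbhd z S"
  by (simp add: nbhd_def)

lemma open_set_Int: "open_set (U \<inter> V)" if U: "open_set U" and V: "open_set V"
  unfolding open_set_def
proof (intro conjI ballI)
  show "U \<inter> V \<subseteq> Q" using U by (auto simp: open_set_def)
next
  fix z assume z: "z \<in> U \<inter> V"
  obtain S where S: "finite S" "S \<subseteq> dm z" "nbhd z S \<subseteq> U"
    using U z unfolding open_set_def by blast
  obtain T where T: "finite T" "T \<subseteq> dm z" "nbhd z T \<subseteq> V"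
    using V z unfolding open_set_def by blast
  have "nbhd z (S \<union> T) \<subseteq> nbhd z S \<inter> nbhd z T"
    by (auto simp: nbhd_def)
  with S T show "\<exists>S. finite S \<and> S \<subseteq> dm z \<and> nbhd z S \<subseteq> U \<inter> V"
    by (intro exI[of _ "S \<union> T"]) auto
qed

lemma openin_pf_topology: "openin pf_topology = open_set"
proof -
  have "open_set (\<Union>\<K>)" if "\<forall>U\<in>\<K>. open_set U" for \<K>
    using that unfolding open_set_def by (meson Sup_upper UnionE Union_least subset_trans)
  then have "istopology open_set"
    unfolding istopology_def by (simp add: open_set_Int)
  then show ?thesis
    by (simp add: pf_topology_def)
qed

text \<open>Any other point of the neighbourhood lies in \<open>D\<close> and so is total; the same
  \<open>S\<close> then serves at that point.\<close>

lemma openin_nbhd: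
  assumes "z \<in> Q" "finite S" "S \<subseteq> dm z"
  shows "openin pf_topology (nbhd z S)"
  unfolding openin_pf_topology open_set_def
proof (intro conjI ballI)
  show "nbhd z S \<subseteq> Q"
    using assms D_subset by (auto simp: nbhd_def)
next
  fix y assume "y \<in> nbhd z S"
  then consider "y = z" | "y \<in> D" "\<forall>i\<in>S. c y i = c z i"
    by (auto simp: nbhd_def)
  then show "\<exists>T. finite T \<and> T \<subseteq> dm y \<and> nbhd y T \<subseteq> nbhd z S"
  proof cases
    case 1
    then show ?thesis using assms by blast
  next
    case 2
    then have "S \<subseteq> dm y"
      using assms dm_subset dm_D by auto
    moreover have "nbhd y S \<subseteq> nbhd z S"
      using 2 by (auto simp: nbhd_def)
    ultimately show ?thesis using assms by blast
  qed
qed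

lemma topspace_pf_topology: "topspace pf_topology = Q"
proof
  show "topspace pf_topology \<subseteq> Q"
    using openin_topspace[of pf_topology] by (simp add: openin_pf_topology open_set_def)
  show "Q \<subseteq> topspace pf_topology"
  proof
    fix z assume "z \<in> Q"
    then have "openin pf_topology (nbhd z {})" by (simp add: openin_nbhd)
    then show "z \<in> topspace pf_topology"
      using nbhd_self openin_subset by blast
  qed
qed

lemma openin_D: "openin pf_topology D"
  unfolding openin_pf_topology open_set_def
proof (intro conjI D_subset ballI)
  fix z assume "z \<in> D"
  then have "nbhd z {} \<subseteq> D"
    by (auto simp: nbhd_def)
  then show "\<exists>S. finite S \<and> S \<subseteq> dm z \<and> nbhd z S \<subseteq> D"
    by blast
qed

lemma openin_meets_D:
  assumes "openin pf_topology U" "U \<noteq> {}"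
  shows "U \<inter> D \<noteq> {}"
proof -
  obtain z where z: "z \<in> U" using assms by blast
  then obtain S where S: "finite S" "S \<subseteq> dm z" "nbhd z S \<subseteq> U"
    using assms unfolding openin_pf_topology open_set_def by blast
  have "z \<in> Q"
    using z assms unfolding openin_pf_topology open_set_def by blast
  then have "S \<subseteq> I"
    using S dm_subset by blast
  then obtain d where "d \<in> D" "\<forall>i\<in>S. c d i = c z i"
    using dense[OF S(1), of "c z"] by blast
  then show ?thesis
    using S by (auto simp: nbhd_def)
qed

lemma closure_of_D: "pf_topology closure_of D = topspace pf_topology"
  using openin_meets_D by (auto simp: dense_intersects_open)

lemma Hausdorff_space_pf_topology: "Hausdorff_space pf_topology"
  unfolding Hausdorff_space_def topspace_pf_topology
proof (intro allI impI, elim conjE)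
  fix y z assume yz: "y \<in> Q" "z \<in> Q" "y \<noteq> z"
  then obtain i where i: "i \<in> dm y" "i \<in> dm z" "c y i \<noteq> c z i"
    using separated by blast
  \<comment> \<open>These facts exclude that one centre lies in the neighbourhood of the other; a
    further common point would agree with both centres at \<open>i\<close>.\<close>
  have "y \<notin> D \<or> c y i \<noteq> c z i" "z \<notin> D \<or> c z i \<noteq> c y i"
    using i by auto
  then have "disjnt (nbhd y {i}) (nbhd z {i})"
    using i yz by (auto simp: nbhd_def disjnt_def)
  moreover have "openin pf_topology (nbhd y {i})" "openin pf_topology (nbhd z {i})"
    using yz i by (simp_all add: openin_nbhd)
  ultimately show "\<exists>U V. openin pf_topology U \<and> openin pf_topology V \<and> y \<in> U \<and> z \<in> V \<and> disjnt U V"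
    using nbhd_self by blast
qed

text \<open>\<open>S\<close> supports a basic open set inside the interior. If \<open>dm z\<close>
  misses \<open>S\<close>, the conditions imposed by \<open>S\<close> and by a neighbourhood of
  \<open>z\<close> concern disjoint sets of indices, so some member of \<open>D\<close> meets
  both.\<close>

lemma RC_plus_finite_support:
  assumes "A \<in> RC_plus pf_topology"
  obtains S where "finite S" "S \<subseteq> I" "\<And>z. z \<in> Q \<Longrightarrow> dm z \<inter> S = {} \<Longrightarrow> z \<in> A"
proof -
  let ?U = "pf_topology interior_of A"
  have A: "A \<noteq> {}" "pf_topology closure_of ?U = A"
    using assms by (auto simp: RC_plus_def)
  then have "?U \<noteq> {}" by auto
  then obtain d where d: "d \<in> ?U" "d \<in> D"
    using openin_meets_D[of ?U] by auto
  then obtain S where S: "finite S" "S \<subseteq> dm d" "nbhd d S \<subseteq> ?U"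
    using openin_interior_of[of pf_topology A] unfolding openin_pf_topology open_set_def by blast
  show thesis
  proof
    show "finite S" "S \<subseteq> I" using S dm_D d by auto
  next
    fix z assume z: "z \<in> Q" "dm z \<inter> S = {}"
    have "\<exists>y. y \<in> ?U \<and> y \<in> V" if V: "z \<in> V" "openin pf_topology V" for V
    proof -
      obtain T where T: "finite T" "T \<subseteq> dm z" "nbhd z T \<subseteq> V"
        using V unfolding openin_pf_topology open_set_def by blast
      have "S \<union> T \<subseteq> I" "finite (S \<union> T)"
        using S T dm_D[OF d(2)] dm_subset[OF z(1)] by auto
      then obtain y where y: "y \<in> D" "\<forall>i\<in>S \<union> T. c y i = (if i \<in> S then c d i else c z i)"
        using dense[of "S \<union> T" "\<lambda>i. if i \<in> S then c d i else c z i"] by blast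
      have "y \<in> nbhd d S" "y \<in> nbhd z T"
        using y T z by (auto simp: nbhd_def)
      then show ?thesis using S T by blast
    qed
    then have "z \<in> pf_topology closure_of ?U"
      using z by (auto simp: in_closure_of topspace_pf_topology)
    then show "z \<in> A" using A by simp
  qed
qed

text \<open>This bounds the density from below. An index is determined by the members of
  \<open>E \<inter> D\<close> with value true there, because \<open>D\<close> is open and has
  functions separating any two indices; hence \<open>I\<close> embeds into
  \<open>Pow E\<close>.\<close>

lemma card_index_le_dense:
  assumes "E \<subseteq> topspace pf_topology" "pf_topology closure_of E = topspace pf_topology"
  shows "|I| \<le>o ctwo ^c |E|"
proof -
  define h where "h i = {d \<in> E \<inter> D. c d i}" for i
  have "inj_on h I"
  proof (rule inj_onI, rule ccontr)
    fix i j assume ij: "i \<in> I" "j \<in> I" "h i = h j" "i \<noteq> j"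
    obtain d where d: "d \<in> D" "c d i" "\<not> c d j"
      using dense[of "{i, j}" "\<lambda>k. k = i"] ij by auto
    have "openin pf_topology (nbhd d {i, j} \<inter> D)"
      using ij d D_subset dm_D by (intro openin_Int openin_nbhd openin_D) auto
    moreover have "d \<in> nbhd d {i, j} \<inter> D"
      using d nbhd_self by auto
    ultimately obtain y where "y \<in> E" "y \<in> nbhd d {i, j}" "y \<in> D"
      using assms(2) unfolding dense_intersects_open by blast
    with d have "y \<in> h i" "y \<notin> h j"
      by (auto simp: h_def nbhd_def)
    with ij show False by simp
  qed
  moreover have "h ` I \<subseteq> Pow E" by (auto simp: h_def)
  ultimately have "|I| \<le>o |Pow E|"
    using card_of_ordLeq by blast
  moreover have "|Pow E| =o ctwo ^c |E|"
    by (simp add: card_of_Pow_Func ctwo_def cexp_def Field_card_of)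
  ultimately show ?thesis
    by (rule ordLeq_ordIso_trans)
qed

end

section \<open>Dense sets of functions\<close>

text \<open>Indices are coded by sets \<open>A i\<close>. A code is a finite set together with a
  family of its possible traces, as in the classical construction of large independent
  families.\<close>

definition hmp_fun :: "('i \<Rightarrow> 's set) \<Rightarrow> 's set \<times> 's set set \<Rightarrow> 'i \<Rightarrow> bool" where
  "hmp_fun A p i \<longleftrightarrow> A i \<inter> fst p \<in> snd p"

definition hmp_codes :: "'s set \<Rightarrow> ('s set \<times> 's set set) set" where
  "hmp_codes X = Fpow X \<times> Fpow (Fpow X)"

text \<open>One point from the symmetric difference of each pair suffices.\<close>

lemma finite_distinguishing_set:
  assumes "finite S" "inj_on A S"
  obtains F where "finite F" "F \<subseteq> (\<Union>i\<in>S. A i)" "inj_on (\<lambda>i. A i \<inter> F) S"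
proof -
  define w where "w i j = (SOME x. x \<in> (A i - A j) \<union> (A j - A i))" for i j
  have w: "w i j \<in> (A i - A j) \<union> (A j - A i)" if "i \<in> S" "j \<in> S" "i \<noteq> j" for i j
  proof -
    have "A i \<noteq> A j" using that assms by (meson inj_onD)
    then have "\<exists>x. x \<in> (A i - A j) \<union> (A j - A i)" by blast
    then show ?thesis unfolding w_def by (rule someI_ex)
  qed
  define F where "F = (\<lambda>(i, j). w i j) ` {(i, j) \<in> S \<times> S. i \<noteq> j}"
  show thesis
  proof
    have "finite {(i, j) \<in> S \<times> S. i \<noteq> j}"
      using assms by (intro finite_subset[OF _ finite_cartesian_product[of S S]]) auto
    then show "finite F" by (simp add: F_def)
    show "F \<subseteq> (\<Union>i\<in>S. A i)"
      using w by (fastforce simp: F_def)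
    show "inj_on (\<lambda>i. A i \<inter> F) S"
    proof (rule inj_onI, rule ccontr)
      fix i j assume ij: "i \<in> S" "j \<in> S" "A i \<inter> F = A j \<inter> F" "i \<noteq> j"
      then have "w i j \<in> F" by (auto simp: F_def)
      with w[of i j] ij show False by blast
    qed
  qed
qed

text \<open>Once \<open>F\<close> separates the finitely many sets, the family of traces of those
  \<open>A i\<close> with \<open>s i\<close> true prescribes all values at once.\<close>

lemma hmp_fun_dense:
  assumes "finite S" "inj_on A S" "\<And>i. i \<in> S \<Longrightarrow> A i \<subseteq> X"
  shows "\<exists>p\<in>hmp_codes X. \<forall>i\<in>S. hmp_fun A p i = s i"
proof -
  obtain F where F: "finite F" "F \<subseteq> (\<Union>i\<in>S. A i)" "inj_on (\<lambda>i. A i \<inter> F) S"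
    using finite_distinguishing_set[OF assms(1,2)] .
  let ?p = "(F, (\<lambda>i. A i \<inter> F) ` {i\<in>S. s i})"
  have "?p \<in> hmp_codes X"
    using F assms by (auto simp: hmp_codes_def Fpow_def)
  moreover have "\<forall>i\<in>S. hmp_fun A ?p i = s i"
    using F(3) by (auto simp: hmp_fun_def dest: inj_onD)
  ultimately show ?thesis by blast
qed

lemma card_hmp_codes:
  assumes "infinite X"
  shows "|hmp_codes X| =o |X|"
proof -
  have 1: "|Fpow X| =o |X|" "infinite (Fpow X)"
    using card_of_Fpow_infinite[OF assms] assms card_of_ordIso_finite by blast+
  have 2: "|Fpow (Fpow X)| =o |X|"
    using card_of_Fpow_infinite[OF 1(2)] 1(1) by (rule ordIso_transitive)
  have "|Fpow X \<times> Fpow (Fpow X)| =o |X \<times> X|"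
    by (rule card_of_Times_cong[OF 1(1) 2])
  also have "|X \<times> X| =o |X|"
    using assms by (rule card_of_Times_same_infinite)
  finally show ?thesis by (simp add: hmp_codes_def)
qed

lemma finite_strict_upper_bound:
  assumes "Card_order \<kappa>" "cinfinite \<kappa>" "finite S" "S \<subseteq> Field \<kappa>"
  shows "\<exists>b\<in>Field \<kappa>. \<forall>a\<in>S. a \<noteq> b \<and> (a, b) \<in> \<kappa>"
  using assms(3,4)
proof (induction S)
  case empty
  have "infinite (Field \<kappa>)" using assms by (simp add: cinfinite_def)
  then show ?case by (metis ball_empty finite.emptyI ex_in_conv)
next
  case (insert x S)
  interpret wo_rel \<kappa>
    using assms by (simp add: wo_rel_def card_order_on_well_order_on)
  obtain b where b: "b \<in> Field \<kappa>" "\<forall>a\<in>S. a \<noteq> b \<and> (a, b) \<in> \<kappa>"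
    using insert by auto
  obtain b' where b': "b' \<in> Field \<kappa>" "(b, b') \<in> \<kappa>" "(x, b') \<in> \<kappa>"
    using TOTALS b insert.prems REFL unfolding refl_on_def by (metis insert_subset)
  \<comment> \<open>An infinite cardinal has no greatest element; the step beyond \<open>b'\<close>
    makes the bound strict.\<close>
  obtain b'' where b'': "b'' \<in> Field \<kappa>" "b' \<noteq> b''" "(b', b'') \<in> \<kappa>"
    using infinite_Card_order_limit[of \<kappa> b'] assms b' by (auto simp: cinfinite_def)
  have "a \<noteq> b'' \<and> (a, b'') \<in> \<kappa>" if "(a, b') \<in> \<kappa>" for a
    using that b'' TRANS ANTISYM unfolding trans_def antisym_def by blast
  moreover have "(a, b') \<in> \<kappa>" if "a \<in> insert x S" for a
    using that b b' TRANS unfolding trans_def by blast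
  ultimately show ?case using b'' by blast
qed

theorem theorem2p2:
  fixes \<kappa> :: "'a rel"
  assumes "Card_order \<kappa>" and "cinfinite \<kappa>"
  shows "\<exists>Z :: 'a topology.
           anti_Urysohn_space Z \<and>
           |topspace Z| =o \<kappa> \<and>
           top_density Z =o card_log \<kappa> \<and>
           (\<forall>\<A>. \<A> \<noteq> {} \<and> \<A> \<subseteq> RC_plus Z \<and> |\<A>| <o cofinality \<kappa> \<longrightarrow> \<Inter>\<A> \<noteq> {})"
proof -
  interpret wo_rel \<kappa>
    using assms by (simp add: wo_rel_def card_order_on_well_order_on)
  let ?Q = "Field \<kappa>"
  have infQ: "infinite ?Q" using assms by (simp add: cinfinite_def)
  have cardQ: "|?Q| =o \<kappa>" using assms(1) by (rule card_of_Field_ordIso)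
  have ctwo_Pow: "|Pow B| =o ctwo ^c |B|" for B :: "'a set"
    by (simp add: card_of_Pow_Func ctwo_def cexp_def Field_card_of)

  \<comment> \<open>A set of cardinality log \<kappa>\<close>
  have "\<kappa> \<le>o ctwo ^c |?Q|"
  proof -
    have "\<kappa> \<le>o |?Q|" using cardQ ordIso_iff_ordLeq by blast
    also have "|?Q| \<le>o |Pow ?Q|" using card_of_Pow ordLess_imp_ordLeq by blast
    also have "|Pow ?Q| =o ctwo ^c |?Q|" by (rule ctwo_Pow)
    finally show ?thesis .
  qed
  note log = least_card_witness[where P = "\<lambda>A::'a set. \<kappa> \<le>o ctwo ^c |A|", OF this,
      folded card_log_def]
  obtain L :: "'a set" where L: "\<kappa> \<le>o ctwo ^c |L|" "card_log \<kappa> = |L|"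
    using log(1) by blast
  have LQ: "|L| \<le>o |?Q|"
    using log(2) L \<open>\<kappa> \<le>o ctwo ^c |?Q|\<close> by metis
  have QL: "|?Q| \<le>o |Pow L|"
    using cardQ L(1) ctwo_Pow[of L]
    by (meson ordIso_ordLeq_trans ordIso_symmetric ordLeq_ordIso_trans)
  then obtain f where f: "inj_on f ?Q" "f ` ?Q \<subseteq> Pow L"
    using card_of_ordLeq by metis
  have infL: "infinite L"
    using QL infQ card_of_ordLeq_infinite by blast

  \<comment> \<open>Indices, functions and names of points\<close>
  define I :: "('a \<times> nat) set" where "I = ?Q \<times> UNIV"
  \<comment> \<open>The summand \<open>{n}\<close> keeps the codes of \<open>(b, n)\<close> distinct
    while a finite set can detect only finitely many \<open>n\<close>.\<close>
  define A :: "'a \<times> nat \<Rightarrow> ('a + nat) set" where "A = (\<lambda>(b, n). f b <+> {n})"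
  let ?X = "L <+> (UNIV :: nat set)"
  have A_inj: "inj_on A I"
  proof (rule inj_onI)
    fix i j assume ij: "i \<in> I" "j \<in> I" "A i = A j"
    obtain b n b' n' where [simp]: "i = (b, n)" "j = (b', n')" by (metis surj_pair)
    have "f b <+> {n} = f b' <+> {n'}" using ij by (simp add: A_def)
    then have "f b = f b'" "n = n'" by (auto simp: set_eq_iff)
    then show "i = j" using f ij by (auto simp: I_def dest: inj_onD)
  qed
  have A_sub: "A i \<subseteq> ?X" if "i \<in> I" for i
    using that f by (auto simp: A_def I_def)

  \<comment> \<open>Restriction to \<open>I\<close> makes the functions extensional, so distinct
    members differ at an index in \<open>I\<close>.\<close>
  define \<D> where "\<D> = (\<lambda>p. restrict (hmp_fun A p) I) ` hmp_codes ?X"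
  have "|\<D>| \<le>o |L|"
  proof -
    have "|\<D>| \<le>o |hmp_codes ?X|" unfolding \<D>_def by (rule card_of_image)
    also have "|hmp_codes ?X| =o |?X|"
      using infL by (intro card_hmp_codes) auto
    also have "|?X| =o |L|"
      using infL infinite_iff_card_of_nat by (intro card_of_Plus_infinite1) auto
    finally show ?thesis .
  qed
  \<comment> \<open>Since \<open>\<D>\<close> is no larger than \<open>?Q\<close>, the elements of
    \<open>?Q\<close> can name both the functions in \<open>\<D>\<close> and the extra
    points.\<close>
  have "|?Q| =o |\<D> <+> ?Q|"
    using \<open>|\<D>| \<le>o |L|\<close> LQ infQ
    by (meson card_of_Plus_infinite2 ordIso_symmetric ordLeq_transitive)
  then obtain g where g: "bij_betw g ?Q (\<D> <+> ?Q)"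
    using card_of_ordIso by metis
  define dm where "dm z = (case g z of Inl d \<Rightarrow> I | Inr a \<Rightarrow> {(b, n). (a, b) \<in> \<kappa>})" for z
  \<comment> \<open>At level \<open>a\<close> the value is \<open>odd n\<close>, at every other
    level \<open>even n\<close>.\<close>
  define c where "c z = (case g z of Inl d \<Rightarrow> d | Inr a \<Rightarrow> (\<lambda>(b, n). even n \<longleftrightarrow> b \<noteq> a))" for z
  define D where "D = {z \<in> ?Q. g z \<in> Inl ` \<D>}"

  txt \<open>
    Every \<open>d \<in> \<D>\<close> is eventually constant in its \<open>\<nat>\<close>-coordinate, while the functions of the points
    \<open>p\<^sub>\<alpha>\<close> alternate there; this is the only purpose of the factor \<open>\<nat>\<close> of \<open>I\<close>.
  \<close>
  have \<D>_parity: "\<exists>n. d (a, n) \<noteq> odd n" if da: "d \<in> \<D>" "a \<in> ?Q" for d a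
  proof -
    obtain p where p: "p \<in> hmp_codes ?X" "d = restrict (hmp_fun A p) I"
      using da(1) unfolding \<D>_def by blast
    have "finite (Inr -` fst p :: nat set)"
      using p by (intro finite_vimageI) (auto simp: hmp_codes_def Fpow_def)
    then obtain m where m: "\<forall>n\<in>Inr -` fst p. n < m"
      using finite_nat_set_iff_bounded by metis
    \<comment> \<open>Beyond \<open>m\<close> the trace no longer depends on \<open>n\<close>, so
      two consecutive values of \<open>d\<close> coincide, whereas \<open>odd n\<close>
      alternates.\<close>
    have "A (a, n) \<inter> fst p = Inl ` f a \<inter> fst p" if "n \<ge> m" for n
    proof -
      have "Inr n \<notin> fst p" using m that by (meson not_le vimageI2)
      then show ?thesis by (auto simp: A_def)
    qed
    from this[of m] this[of "Suc m"]
    have "A (a, m) \<inter> fst p = A (a, Suc m) \<inter> fst p" by simp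
    then have "d (a, m) = d (a, Suc m)"
      using da p by (simp add: hmp_fun_def I_def)
    then show ?thesis by (metis even_Suc)
  qed

  \<comment> \<open>Separation of points\<close>
  have g_cases: "(\<exists>d\<in>\<D>. g z = Inl d) \<or> (\<exists>a\<in>?Q. g z = Inr a)" if "z \<in> ?Q" for z
    using bij_betwE[OF g] that by blast
  \<comment> \<open>The larger level \<open>b\<close> lies in both domains; at \<open>(b, 0)\<close>
    only the point of level \<open>b\<close> has value false.\<close>
  have separate_Inr: "\<exists>i \<in> dm y \<inter> dm z. c y i \<noteq> c z i"
    if "y \<in> ?Q" "g y = Inr a" "g z = Inr b" "a \<noteq> b" "(a, b) \<in> \<kappa>" for y z a b
  proof -
    have "(b, b) \<in> \<kappa>" using that REFL by (simp add: refl_on_def FieldI2)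
    then show ?thesis using that by (intro bexI[of _ "(b, 0)"]) (auto simp: dm_def c_def)
  qed
  have separate_mixed: "\<exists>i \<in> dm y \<inter> dm z. c y i \<noteq> c z i"
    if yz: "d \<in> \<D>" "g y = Inl d" "g z = Inr a" "a \<in> ?Q" for y z a d
  proof -
    obtain n where "d (a, n) \<noteq> odd n" using \<D>_parity yz by blast
    moreover have "(a, a) \<in> \<kappa>" using yz REFL by (simp add: refl_on_def)
    ultimately show ?thesis
      using yz by (intro bexI[of _ "(a, n)"]) (auto simp: dm_def c_def I_def)
  qed

  interpret Z: partial_function_space ?Q D I dm c
  proof
    show "D \<subseteq> ?Q" by (auto simp: D_def)
    show "dm d = I" if "d \<in> D" for d using that by (auto simp: D_def dm_def)
    show "dm z \<subseteq> I" if "z \<in> ?Q" for z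
      by (auto simp: dm_def I_def split: sum.splits intro: FieldI2)
  next
    fix y z assume yz: "y \<in> ?Q" "z \<in> ?Q" "y \<noteq> z"
    then have "g y \<noteq> g z" using g by (auto simp: bij_betw_def dest: inj_onD)
    consider (DD) d d' where "d \<in> \<D>" "d' \<in> \<D>" "g y = Inl d" "g z = Inl d'"
      | (DP) d a where "d \<in> \<D>" "a \<in> ?Q" "g y = Inl d" "g z = Inr a"
      | (PD) d a where "d \<in> \<D>" "a \<in> ?Q" "g z = Inl d" "g y = Inr a"
      | (PP) a b where "a \<in> ?Q" "b \<in> ?Q" "g y = Inr a" "g z = Inr b"
      using g_cases[OF yz(1)] g_cases[OF yz(2)] that by (elim disjE bexE) simp_all
    then show "\<exists>i \<in> dm y \<inter> dm z. c y i \<noteq> c z i"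
    proof cases
      case DD
      then have "d \<noteq> d'" "d \<in> extensional I" "d' \<in> extensional I"
        using \<open>g y \<noteq> g z\<close> by (auto simp: \<D>_def)
      then obtain i where "i \<in> I" "d i \<noteq> d' i" using extensionalityI[of d I d'] by blast
      with DD show ?thesis by (auto simp: dm_def c_def)
    next
      case DP
      then show ?thesis using separate_mixed[of d y z a] by blast
    next
      case PD
      then show ?thesis using separate_mixed[of d z y a] by blast
    next
      case PP
      then have "a \<noteq> b" using \<open>g y \<noteq> g z\<close> by auto
      then have "(a, b) \<in> \<kappa> \<or> (b, a) \<in> \<kappa>"
        using TOTALS PP by blast
      then show ?thesis
        using separate_Inr[of y a z b] separate_Inr[of z b y a] PP \<open>a \<noteq> b\<close> yz by blast
    qed
  next
    fix S s assume S: "finite S" "S \<subseteq> I"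
    obtain p where p: "p \<in> hmp_codes ?X" "\<forall>i\<in>S. hmp_fun A p i = s i"
      using hmp_fun_dense[of S A ?X s] S A_inj A_sub inj_on_subset by blast
    let ?d = "restrict (hmp_fun A p) I"
    have "?d \<in> \<D>" using p by (auto simp: \<D>_def)
    then have "Inl ?d \<in> g ` ?Q" using g by (auto simp: bij_betw_def)
    then obtain z where z: "z \<in> ?Q" "g z = Inl ?d" by force
    have "z \<in> D" using z \<open>?d \<in> \<D>\<close> by (auto simp: D_def)
    moreover have "\<forall>i\<in>S. c z i = s i"
      using z p S by (auto simp: c_def)
    ultimately show "\<exists>d\<in>D. \<forall>i\<in>S. c d i = s i" by blast
  qed

  \<comment> \<open>Tails contained in regular closed sets\<close>
  define pt where "pt a = inv_into ?Q g (Inr a)" for a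
  have pt: "pt a \<in> ?Q" "g (pt a) = Inr a" if "a \<in> ?Q" for a
  proof -
    have "Inr a \<in> g ` ?Q" using that g by (auto simp: bij_betw_def)
    then show "pt a \<in> ?Q" "g (pt a) = Inr a"
      unfolding pt_def by (auto intro: inv_into_into f_inv_into_f)
  qed
  have tail: "\<exists>b\<in>?Q. \<forall>a. (b, a) \<in> \<kappa> \<longrightarrow> pt a \<in> B" if B: "B \<in> RC_plus Z.pf_topology" for B
  proof -
    obtain S where S: "finite S" "S \<subseteq> I" "\<And>z. z \<in> ?Q \<Longrightarrow> dm z \<inter> S = {} \<Longrightarrow> z \<in> B"
      using Z.RC_plus_finite_support[OF B] by blast
    have "finite (fst ` S)" "fst ` S \<subseteq> ?Q" using S by (auto simp: I_def)
    \<comment> \<open>Strictness matters already for \<open>a = b\<close>: the domain of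
      \<open>pt a\<close> includes level \<open>a\<close> itself and must miss
      \<open>S\<close>.\<close>
    then obtain b where b: "b \<in> ?Q" "\<forall>x\<in>fst ` S. x \<noteq> b \<and> (x, b) \<in> \<kappa>"
      using finite_strict_upper_bound assms by metis
    have "pt a \<in> B" if "(b, a) \<in> \<kappa>" for a
    proof (rule S(3))
      have a: "a \<in> ?Q" using that by (rule FieldI2)
      then show "pt a \<in> ?Q" by (rule pt)
      have "(a, x) \<notin> \<kappa>" if "x \<in> fst ` S" for x
        using that b \<open>(b, a) \<in> \<kappa>\<close> TRANS ANTISYM unfolding trans_def antisym_def by blast
      then show "dm (pt a) \<inter> S = {}"
        using pt(2)[OF a] by (force simp: dm_def)
    qed
    then show ?thesis using b by blast
  qed

  have "anti_Urysohn_space Z.pf_topology"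
    unfolding anti_Urysohn_space_def
  proof (intro conjI ballI)
    show "infinite (topspace Z.pf_topology)" using infQ by (simp add: Z.topspace_pf_topology)
    show "Hausdorff_space Z.pf_topology" by (rule Z.Hausdorff_space_pf_topology)
  next
    fix B C assume "B \<in> RC_plus Z.pf_topology" "C \<in> RC_plus Z.pf_topology"
    then obtain b b' where b: "b \<in> ?Q" "\<forall>a. (b, a) \<in> \<kappa> \<longrightarrow> pt a \<in> B"
      and b': "b' \<in> ?Q" "\<forall>a. (b', a) \<in> \<kappa> \<longrightarrow> pt a \<in> C"
      using tail by meson
    have "(b, b) \<in> \<kappa>" "(b', b') \<in> \<kappa>" "(b, b') \<in> \<kappa> \<or> (b', b) \<in> \<kappa>"
      using b b' TOTALS REFL by (auto simp: refl_on_def)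
    \<comment> \<open>The larger of \<open>b\<close> and \<open>b'\<close> indexes a common
      point.\<close>
    then show "B \<inter> C \<noteq> {}" using b b' by blast
  qed
  moreover have "|topspace Z.pf_topology| =o \<kappa>"
    using cardQ by (simp add: Z.topspace_pf_topology)

  \<comment> \<open>The density\<close>
  moreover have "top_density Z.pf_topology =o card_log \<kappa>"
  proof -
    have "D \<subseteq> topspace Z.pf_topology \<and> Z.pf_topology closure_of D = topspace Z.pf_topology"
      using Z.D_subset Z.closure_of_D by (simp add: Z.topspace_pf_topology)
    note dens = least_card_witness[where P = "\<lambda>D. D \<subseteq> topspace Z.pf_topology \<and>
        Z.pf_topology closure_of D = topspace Z.pf_topology", OF this, folded top_density_def]
    obtain E where E: "E \<subseteq> topspace Z.pf_topology" "Z.pf_topology closure_of E = topspace Z.pf_topology"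
        "top_density Z.pf_topology = |E|"
      using dens(1) by blast
    have "|?Q| \<le>o |I|"
      unfolding I_def by (rule card_of_Times1) simp
    then have "\<kappa> \<le>o ctwo ^c |E|"
      using cardQ Z.card_index_le_dense[OF E(1,2)]
      by (meson ordIso_ordLeq_trans ordIso_symmetric ordLeq_transitive)
    then have ge: "card_log \<kappa> \<le>o top_density Z.pf_topology"
      using log(2) E by simp
    have "|D| \<le>o |\<D>|"
    proof -
      have "inj_on g D"
        using g Z.D_subset by (meson bij_betw_imp_inj_on inj_on_subset)
      moreover have "g ` D \<subseteq> Inl ` \<D>" by (auto simp: D_def)
      ultimately have "|D| \<le>o |(Inl :: _ \<Rightarrow> _ + 'a) ` \<D>|"
        using card_of_ordLeq by blast
      also have "|(Inl :: _ \<Rightarrow> _ + 'a) ` \<D>| \<le>o |\<D>|" by (rule card_of_image)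
      finally show ?thesis .
    qed
    moreover have "top_density Z.pf_topology \<le>o |D|"
      using dens(2) Z.D_subset Z.closure_of_D by (simp add: Z.topspace_pf_topology)
    ultimately have "top_density Z.pf_topology \<le>o card_log \<kappa>"
      using \<open>|\<D>| \<le>o |L|\<close> L(2) by (metis ordLeq_transitive)
    with ge show ?thesis by (simp add: ordIso_iff_ordLeq)
  qed

  \<comment> \<open>Intersections of fewer than cf \<kappa> sets\<close>
  moreover have "\<Inter>\<A> \<noteq> {}"
    if \<A>: "\<A> \<noteq> {}" "\<A> \<subseteq> RC_plus Z.pf_topology" "|\<A>| <o cofinality \<kappa>" for \<A>
  proof -
    obtain t where t: "\<And>B. B \<in> \<A> \<Longrightarrow> t B \<in> ?Q \<and> (\<forall>a. (t B, a) \<in> \<kappa> \<longrightarrow> pt a \<in> B)"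
      using tail \<A>(2) by (metis subsetD)
    have "\<not> cofinal (t ` \<A>) \<kappa>"
    proof
      assume "cofinal (t ` \<A>) \<kappa>"
      then have K: "t ` \<A> \<subseteq> ?Q \<and> cofinal (t ` \<A>) \<kappa>" using t by blast
      have "cofinality \<kappa> \<le>o |t ` \<A>|"
        unfolding cofinality_def
        by (rule least_card_witness(2)[where P = "\<lambda>K. K \<subseteq> ?Q \<and> cofinal K \<kappa>", OF K K])
      then have "cofinality \<kappa> \<le>o |\<A>|"
        using card_of_image ordLeq_transitive by blast
      with \<A>(3) show False using not_ordLess_ordLeq by blast
    qed
    \<comment> \<open>As \<open>cofinal\<close> asks for strictly larger elements, its failure
      yields \<open>a\<close> with no \<open>t B\<close> strictly above it; by totality
      \<open>a\<close> lies in every tail.\<close>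
    then obtain a where a: "a \<in> ?Q" "\<forall>b\<in>t ` \<A>. \<not> (a \<noteq> b \<and> (a, b) \<in> \<kappa>)"
      by (auto simp: cofinal_def)
    have "pt a \<in> B" if "B \<in> \<A>" for B
    proof -
      have "t B \<in> ?Q" using t that by blast
      then have "(t B, a) \<in> \<kappa>"
        using a that TOTALS REFL unfolding refl_on_def by (metis imageI)
      then show ?thesis using t that by blast
    qed
    then show ?thesis by blast
  qed
  ultimately show ?thesis by blast
qed

end
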